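(* Let $\alpha>0$ and $\beta\ge 0$ be real numbers, and let $f\in\mathcal{A}$ satisfy $f(z)f'(z)/z\neq 0$ for all $z\in\mathbb{D}$. If at least one of the following inequalities holds for all $z\in\mathbb{D}$: (i) $\operatorname{Re}\left(\alpha\dfrac{Q_{CV}}{Q_{ST}}+\beta\dfrac{Q_{SD}}{Q_{ST}}\right)<\dfrac{3\alpha}{2}$; (ii) $\operatorname{Re}\left(\alpha\dfrac{Q_{CV}}{Q_{ST}}+\beta\dfrac{Q_{SD}}{Q_{CV}}\right)<\dfrac{3\alpha}{2}$; then $f$ is starlike.
   Context: $\mathbb{D}=\{z\in\mathbb{C}:|z|<1\}$. $\mathcal{A}$ is the class of analytic functions $f:\mathbb{D}\to\mathbb{C}$ with $f(0)=0$ and $f'(0)=1$. For $f\in\mathcal{A}$, as functions of $z\in\mathbb{D}$: $Q_{ST}=zf'(z)/f(z)$ (with the removable singularity at $z=0$ filled in, value $1$), $Q_{CV}=1+zf''(z)/f'(z)$, and $Q_{SD}=z^2\Big(\big(f''(z)/f'(z)\big)'-\tfrac12\big(f''(z)/f'(z)\big)^2\Big)$ ($z^2$ times the Schwarzian derivative of $f$). The condition $f(z)f'(z)/z\neq0$ is understood at $z=0$ via the removable singularity (where the value is $1$). An inequality containing a quotient is understood to include the requirement that the denominators appearing in it do not vanish in $\mathbb{D}$. A function $f\in\mathcal{A}$ is starlike if $\operatorname{Re}Q_{ST}>0$ on $\mathbb{D}$; equivalently, $f$ is univalent and $tf(z)\in f(\mathbb{D})$ for all $z\in\mathbb{D}$,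 $t\in[0,1]$. *)

theory Defs
  imports "HOL-Complex_Analysis.Complex_Analysis"
begin

abbreviation unit_disc :: "complex set" where
  "unit_disc \<equiv> ball 0 1"

text \<open>Functions on the disc are total functions on \<^typ>\<open>complex\<close>; everything below depends only on
  their values in the (open) unit disc.\<close>

definition class_A :: "(complex \<Rightarrow> complex) set" where
  "class_A = {f. f holomorphic_on unit_disc \<and> f 0 = 0 \<and> deriv f 0 = 1}"

text \<open>\<open>f(z) f'(z) / z\<close> and \<open>z f'(z) / f(z)\<close> have a removable singularity at \<open>0\<close>, where the value
  is 1; see the two limit lemmas below.\<close>

definition ff'_over_z :: "(complex \<Rightarrow> complex) \<Rightarrow> complex \<Rightarrow> complex" where
  "ff'_over_z f z = (if z = 0 then 1 else f z * deriv f z / z)"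

definition Q_ST :: "(complex \<Rightarrow> complex) \<Rightarrow> complex \<Rightarrow> complex" where
  "Q_ST f z = (if z = 0 then 1 else z * deriv f z / f z)"

definition Q_CV :: "(complex \<Rightarrow> complex) \<Rightarrow> complex \<Rightarrow> complex" where
  "Q_CV f z = 1 + z * deriv (deriv f) z / deriv f z"

definition schwarzian :: "(complex \<Rightarrow> complex) \<Rightarrow> complex \<Rightarrow> complex" where
  "schwarzian f z =
     deriv (\<lambda>w. deriv (deriv f) w / deriv f w) z - 1 / 2 * (deriv (deriv f) z / deriv f z)\<^sup>2"

definition Q_SD :: "(complex \<Rightarrow> complex) \<Rightarrow> complex \<Rightarrow> complex" where
  "Q_SD f z = z\<^sup>2 * schwarzian f z"

text \<open>Where \<open>f z = 0\<close> with \<open>z \<noteq> 0\<close>, HOL's convention \<open>x / 0 = 0\<close> gives \<open>Q_ST f z = 0\<close>, so the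
  positivity condition already forces the denominator not to vanish.\<close>

definition starlike_function :: "(complex \<Rightarrow> complex) \<Rightarrow> bool" where
  "starlike_function f \<longleftrightarrow> f \<in> class_A \<and> (\<forall>z\<in>unit_disc. Re (Q_ST f z) > 0)"

lemma class_A_limits:
  assumes "f \<in> class_A"
  shows "((\<lambda>z. f z / z) \<longlongrightarrow> 1) (at 0)" and "(deriv f \<longlongrightarrow> 1) (at 0)"
proof -
  have hol: "f holomorphic_on unit_disc" and f0: "f 0 = 0" "deriv f 0 = 1"
    using assms by (auto simp: class_A_def)
  have "(f has_field_derivative 1) (at 0)"
    using holomorphic_derivI[OF hol, of 0] f0 by simp
  then show "((\<lambda>z. f z / z) \<longlongrightarrow> 1) (at 0)"
    using f0 by (simp add: has_field_derivative_iff)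
  have "isCont (deriv f) 0"
    using holomorphic_on_imp_continuous_on[OF holomorphic_deriv[OF hol]]
      continuous_on_eq_continuous_at[of unit_disc "deriv f"] by simp
  then show "(deriv f \<longlongrightarrow> 1) (at 0)"
    using f0 by (simp add: isCont_def)
qed

lemma ff'_over_z_limit:
  assumes "f \<in> class_A"
  shows "((\<lambda>z. f z * deriv f z / z) \<longlongrightarrow> ff'_over_z f 0) (at 0)"
  using tendsto_mult[OF class_A_limits[OF assms]] by (simp add: ff'_over_z_def)

lemma Q_ST_limit:
  assumes "f \<in> class_A"
  shows "((\<lambda>z. z * deriv f z / f z) \<longlongrightarrow> Q_ST f 0) (at 0)"
  using tendsto_divide[OF class_A_limits(2,1)[OF assms]]
  by (simp add: Q_ST_def mult.commute)

end

theory Submission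
  imports Defs
begin

text \<open>
  The argument is of Miller--Mocanu type: the inequality of the hypothesis fails at the first point
  where starlikeness breaks down.  Work with \<open>q(z) = f(z) / (z f'(z)) = 1 / Q_ST\<close>, which is
  holomorphic and zero-free on the disc and has \<open>q(0) = 1\<close>; starlikeness is equivalent to
  \<open>Re q > 0\<close>.  If this fails, take a point \<open>z\<close> of least modulus with \<open>Re q(z) = 0\<close>
  and put \<open>L = z q'(z) + z\<^sup>2 q''(z)\<close>.

  Minimality of \<open>Re q\<close> on the circle through \<open>z\<close> makes \<open>s = z q'(z)\<close> real and gives
  \<open>Re L \<le> 0\<close>; in the radial direction, Harnack's inequality \<open>Re q(rz) \<ge> (1-r)/(1+r)\<close>, an
  equality at \<open>r = 1\<close>, gives \<open>s \<le> -1/2\<close> (lemma \<open>first_zero_of_Re\<close>).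

  Writing \<open>P = Q_CV\<close>, differentiation of \<open>f = z q f'\<close> yields \<open>q P = 1 - z q'\<close>, and a second
  differentiation yields
  \<open>q Q_SD = - L - z q' P + q (1 - P\<^sup>2) / 2\<close> (lemma \<open>Q_CV_Q_SD_identities\<close>).
  At the critical point \<open>q\<close> is purely imaginary and \<open>1 - s\<close> is real, hence \<open>P\<close> is purely
  imaginary as well, and everything but \<open>- L\<close> disappears from the real part:
  \<open>Q_CV / Q_ST = 1 - s \<ge> 3/2\<close>, \<open>Re (Q_SD / Q_ST) = - Re L \<ge> 0\<close> and
  \<open>Re (Q_SD / Q_CV) = - Re L / (1 - s) \<ge> 0\<close>.  Both forms of the hypothesis are contradicted.
\<close>

section \<open>Boundary behaviour at the first zero of the real part\<close>

text \<open>The Cayley transform \<open>(1 - q) / (1 + q)\<close> maps the right half-plane to the disc and vanishes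
  at \<open>0\<close>, so Schwarz's lemma bounds it by \<open>norm z\<close>; solving for \<open>Re q\<close> gives
  the bound.\<close>

lemma Harnack_lower_bound:
  assumes hol: "q holomorphic_on ball 0 1" and q0: "q 0 = 1"
    and pos: "\<And>w. norm w < 1 \<Longrightarrow> Re (q w) > 0" and z: "norm z < 1"
  shows "Re (q z) \<ge> (1 - norm z) / (1 + norm z)"
proof -
  define w where "w = (\<lambda>z. (1 - q z) / (1 + q z))"
  have nz: "1 + q z \<noteq> 0" if "norm z < 1" for z
    using pos[OF that] by (auto simp: complex_eq_iff)
  have "w holomorphic_on ball 0 1"
    unfolding w_def by (intro holomorphic_intros hol) (use nz in auto)
  moreover have "w 0 = 0" by (simp add: w_def q0)
  moreover have "norm (w z) < 1" if "norm z < 1" for z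
  proof -
    have "(norm (1 - q z))\<^sup>2 < (norm (1 + q z))\<^sup>2"
      unfolding cmod_power2 using pos[OF that] by (simp add: power2_eq_square algebra_simps)
    then have "norm (1 - q z) < norm (1 + q z)"
      by (rule power_less_imp_less_base) simp
    then show ?thesis
      using nz[OF that] by (simp add: w_def norm_divide)
  qed
  ultimately have "norm (w z) \<le> norm z"
    using Schwarz_Lemma(1)[of w z] z by blast
  then have "norm (1 - q z) \<le> norm z * norm (1 + q z)"
    using nz[OF z] by (simp add: w_def norm_divide divide_simps)
  then have "(norm (1 - q z))\<^sup>2 \<le> (norm z)\<^sup>2 * (norm (1 + q z))\<^sup>2"
    by (metis norm_ge_zero power_mono power_mult_distrib)
  moreover define r x y where "r = norm z" and "x = Re (q z)" and "y = Im (q z)"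
  ultimately have "(1 - x)\<^sup>2 + y\<^sup>2 \<le> r\<^sup>2 * ((1 + x)\<^sup>2 + y\<^sup>2)"
    by (simp add: cmod_power2)
  moreover have r: "0 \<le> r" "r < 1" and x: "x > 0"
    using z pos[OF z] by (auto simp: r_def x_def)
  moreover have "r\<^sup>2 * y\<^sup>2 \<le> y\<^sup>2"
    using r by (simp add: mult_left_le_one_le power_le_one)
  ultimately have "(1 - x)\<^sup>2 \<le> (r * (1 + x))\<^sup>2"
    unfolding power_mult_distrib distrib_left[of "r\<^sup>2"] by linarith
  then have "1 - x \<le> r * (1 + x)"
    by (rule power2_le_imp_le) (use r x in auto)
  then have "(1 - r) / (1 + r) \<le> x"
    using r by (simp add: divide_simps algebra_simps)
  then show ?thesis by (simp add: r_def x_def)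
qed

lemma second_derivative_nonneg_at_minimum:
  fixes u u' :: "real \<Rightarrow> real"
  assumes u: "\<And>t. (u has_real_derivative u' t) (at t)"
    and u': "(u' has_real_derivative c) (at 0)"
    and min: "\<And>t. u 0 \<le> u t"
  shows "u' 0 = 0" "c \<ge> 0"
proof -
  show u0: "u' 0 = 0"
    using DERIV_local_min[OF u[of 0], of 1] min by simp
  show "c \<ge> 0"
  proof (rule ccontr)
    assume "\<not> c \<ge> 0"
    then obtain d where d: "d > 0" "\<And>h. 0 < h \<Longrightarrow> h < d \<Longrightarrow> u' h < 0"
      using DERIV_neg_dec_right[OF u'] u0 by auto
    obtain z where z: "0 < z" "z < d / 2" "u (d / 2) - u 0 = (d / 2 - 0) * u' z"
      using MVT2[of 0 "d / 2" u u'] u d(1) by auto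
    have "u' z < 0" using d z by auto
    then have "(d / 2 - 0) * u' z < 0" using d(1) by (simp add: mult_pos_neg)
    with z min[of "d / 2"] show False by linarith
  qed
qed

text \<open>The conclusions are the derivative tests for \<open>t \<mapsto> Re (q (z e\<^sup>i\<^sup>t))\<close> at its minimum
  \<open>t = 0\<close>, and for \<open>r \<mapsto> Re (q (r z)) - (1 - r) / (1 + r)\<close>, which is nonnegative for \<open>r < 1\<close>
  by Harnack's inequality and zero at \<open>r = 1\<close>.\<close>

lemma first_zero_of_Re:
  assumes hol: "q holomorphic_on S" and S: "open S" "cball 0 (norm z) \<subseteq> S"
    and q0: "q 0 = 1" and qz: "Re (q z) = 0"
    and pos: "\<And>w. norm w < norm z \<Longrightarrow> Re (q w) > 0"
  shows "Im (z * deriv q z) = 0" and "Re (z * deriv q z) \<le> - 1 / 2"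
    and "Re (z * deriv q z + z\<^sup>2 * deriv (deriv q) z) \<le> 0"
proof -
  have dq: "(q has_field_derivative deriv q w) (at w)" if "norm w \<le> norm z" for w
    using holomorphic_derivI[OF hol S(1)] S(2) that by auto
  have ddq: "(deriv q has_field_derivative deriv (deriv q) w) (at w)" if "norm w \<le> norm z" for w
    using holomorphic_derivI[OF holomorphic_deriv[OF hol S(1)] S(1)] S(2) that by auto
  have "z \<noteq> 0" using q0 qz by auto
  have nonneg: "Re (q w) \<ge> 0" if "norm w \<le> norm z" for w
  proof (rule continuous_ge_on_closure[of "ball 0 (norm z)" "\<lambda>w. Re (q w)"])
    have "continuous_on (cball 0 (norm z)) q"
      using continuous_on_subset[OF holomorphic_on_imp_continuous_on[OF hol] S(2)] .
    then show "continuous_on (closure (ball 0 (norm z))) (\<lambda>w. Re (q w))"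
      using \<open>z \<noteq> 0\<close> by (simp add: continuous_on_Re)
    show "w \<in> closure (ball 0 (norm z))" using that \<open>z \<noteq> 0\<close> by simp
    show "Re (q x) \<ge> 0" if "x \<in> ball 0 (norm z)" for x
      using pos[of x] that by simp
  qed

  \<comment> \<open>The circle through \<open>z\<close>: there \<open>Re q\<close> is minimal at angle \<open>0\<close>.\<close>
  define e where "e = (\<lambda>t::real. z * exp (\<i> * of_real t))"
  have ne: "norm (e t) = norm z" for t
    by (simp add: e_def norm_mult)
  have de: "(e has_vector_derivative (\<i> * e t)) (at t)" for t
    unfolding e_def by (auto intro!: derivative_eq_intros has_vector_derivative_real_field)
  define u where "u = (\<lambda>t. Re (q (e t)))"
  define u' where "u' = (\<lambda>t. Re (\<i> * e t * deriv q (e t)))"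
  have "((\<lambda>t. q (e t)) has_vector_derivative (\<i> * e t * deriv q (e t))) (at t)" for t
    using field_vector_diff_chain_at[OF de dq[of "e t"]] ne[of t] by (simp add: o_def)
  then have u: "(u has_real_derivative u' t) (at t)" for t
    unfolding u_def u'_def has_real_derivative_iff_has_vector_derivative
    by (rule bounded_linear.has_vector_derivative[OF bounded_linear_Re])
  have "((\<lambda>t. deriv q (e t)) has_vector_derivative (\<i> * e t * deriv (deriv q) (e t))) (at t)" for t
    using field_vector_diff_chain_at[OF de ddq[of "e t"]] ne[of t] by (simp add: o_def)
  then have "((\<lambda>t. \<i> * e t * deriv q (e t)) has_vector_derivative
      (\<i> * e 0 * (\<i> * e 0 * deriv (deriv q) (e 0)) + \<i> * (\<i> * e 0) * deriv q (e 0))) (at 0)"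
    by (intro has_vector_derivative_mult de has_vector_derivative_mult_right)
  then have "(u' has_real_derivative
      Re (\<i> * e 0 * (\<i> * e 0 * deriv (deriv q) (e 0)) + \<i> * (\<i> * e 0) * deriv q (e 0))) (at 0)"
    unfolding u'_def has_real_derivative_iff_has_vector_derivative
    by (rule bounded_linear.has_vector_derivative[OF bounded_linear_Re])
  moreover have "\<i> * e 0 * (\<i> * e 0 * deriv (deriv q) (e 0)) + \<i> * (\<i> * e 0) * deriv q (e 0)
      = - (z * deriv q z + z\<^sup>2 * deriv (deriv q) z)"
    by (simp add: e_def power2_eq_square algebra_simps)
  ultimately have u'0:
    "(u' has_real_derivative Re (- (z * deriv q z + z\<^sup>2 * deriv (deriv q) z))) (at 0)"
    by (simp only:)
  have min: "u 0 \<le> u t" for t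
    using nonneg[of "e t"] ne[of t] qz by (simp add: u_def e_def)
  note test = second_derivative_nonneg_at_minimum[OF u u'0 min]
  show "Im (z * deriv q z) = 0"
    using test(1) by (simp add: u'_def e_def algebra_simps)
  show "Re (z * deriv q z + z\<^sup>2 * deriv (deriv q) z) \<le> 0"
    using test(2) by simp

  define v where "v = (\<lambda>r::real. Re (q (of_real r * z)) - (1 - r) / (1 + r))"
  have "((\<lambda>r::real. of_real r * z) has_vector_derivative z) (at 1)"
    by (auto intro!: derivative_eq_intros)
  then have "((\<lambda>r::real. q (of_real r * z)) has_vector_derivative z * deriv q z) (at 1)"
    using field_vector_diff_chain_at[of "\<lambda>r::real. of_real r * z" z 1 q "deriv q z"] dq[of z]
    by (simp add: o_def)
  then have "((\<lambda>r::real. Re (q (of_real r * z))) has_real_derivative Re (z * deriv q z)) (at 1)"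
    unfolding has_real_derivative_iff_has_vector_derivative
    by (rule bounded_linear.has_vector_derivative[OF bounded_linear_Re])
  moreover have "((\<lambda>r::real. (1 - r) / (1 + r)) has_real_derivative - 1 / 2) (at 1)"
    by (auto intro!: derivative_eq_intros)
  ultimately have "(v has_real_derivative Re (z * deriv q z) - - 1 / 2) (at 1)"
    unfolding v_def by (rule DERIV_diff)
  then have v: "(v has_real_derivative Re (z * deriv q z) + 1 / 2) (at 1)"
    by (simp only: minus_divide_left[symmetric] diff_minus_eq_add)
  have v_nonneg: "v r \<ge> 0" if r: "0 < r" "r < 1" for r
  proof -
    have lt: "norm (w * z) < norm z" if "norm w < 1" for w
      using that \<open>z \<noteq> 0\<close> by (simp add: norm_mult)
    have "(\<lambda>w. q (w * z)) holomorphic_on ball 0 1"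
    proof (rule holomorphic_on_compose_gen[unfolded o_def, OF _ hol])
      show "(\<lambda>w. w * z) ` ball 0 1 \<subseteq> S"
        using lt S(2) by (force simp: less_imp_le)
    qed (intro holomorphic_intros)
    then have "(1 - norm (of_real r :: complex)) / (1 + norm (of_real r :: complex))
        \<le> Re (q (of_real r * z))"
      by (rule Harnack_lower_bound) (use q0 pos lt r in auto)
    then show ?thesis using r by (simp add: v_def)
  qed
  show "Re (z * deriv q z) \<le> - 1 / 2"
  proof (rule ccontr)
    assume "\<not> ?thesis"
    then obtain d where d: "d > 0" "\<And>h. 0 < h \<Longrightarrow> h < d \<Longrightarrow> v (1 - h) < v 1"
      using DERIV_pos_inc_left[OF v] by auto
    define h where "h = min d 1 / 2"
    have h: "0 < h" "h < d" "h < 1" using d(1) by (auto simp: h_def)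
    have "v 1 = 0" using qz by (simp add: v_def)
    then show False using d(2)[OF h(1,2)] v_nonneg[of "1 - h"] h by simp
  qed
qed

text \<open>The point is one of least modulus in the compact set where \<open>norm z \<le> norm w\<close> and
  \<open>Re (q z) \<le> 0\<close>.\<close>

lemma exists_first_zero_of_Re:
  fixes q :: "complex \<Rightarrow> complex"
  assumes cont_q: "continuous_on (ball 0 1) q" and q0: "q 0 = 1"
    and w: "norm w < 1" "Re (q w) \<le> 0"
  obtains z where "norm z < 1" "Re (q z) = 0" "\<And>w. norm w < norm z \<Longrightarrow> Re (q w) > 0"
proof -
  define K where "K = {z \<in> cball 0 (norm w). Re (q z) \<le> 0}"
  have sub: "cball 0 (norm w) \<subseteq> ball 0 1" using w by auto
  have cont: "continuous_on (cball 0 (norm w)) (\<lambda>z. Re (q z))"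
    by (intro continuous_intros continuous_on_subset[OF cont_q sub])
  have "closed K"
    unfolding K_def by (intro continuous_on_closed_Collect_le cont continuous_on_const closed_cball)
  then have "compact K"
    using compact_Int_closed[of "cball 0 (norm w)" K] by (simp add: K_def Int_def)
  moreover have "K \<noteq> {}" using w by (auto simp: K_def)
  ultimately obtain z where z: "z \<in> K" "\<And>y. y \<in> K \<Longrightarrow> norm z \<le> norm y"
    using continuous_attains_inf[of K norm] continuous_on_norm_id by blast
  have pos: "Re (q y) > 0" if "norm y < norm z" for y
    using z(1) z(2)[of y] that by (force simp: K_def)
  \<comment> \<open>On the segment from \<open>0\<close> to \<open>z\<close> the real part is continuous, so a negative value at \<open>z\<close>
    would force a zero of smaller modulus.\<close>
  have "Re (q z) = 0"
  proof (rule ccontr)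
    assume "Re (q z) \<noteq> 0"
    then have neg: "Re (q z) < 0" using z(1) by (auto simp: K_def)
    have "continuous_on {0..1} (\<lambda>r::real. Re (q (of_real r * z)))"
    proof (rule continuous_on_compose2[OF cont])
      show "(\<lambda>r. of_real r * z) ` {0..1} \<subseteq> cball 0 (norm w)"
        using z(1) by (auto simp: K_def norm_mult intro!: order_trans[OF mult_left_le_one_le])
    qed (intro continuous_intros)
    then obtain r where r: "0 \<le> r" "r \<le> 1" "Re (q (of_real r * z)) = 0"
      using IVT2'[of "\<lambda>r::real. Re (q (of_real r * z))" 1 0 0] neg q0 by auto
    then have "r \<noteq> 1" using neg by auto
    moreover have "z \<noteq> 0" using neg q0 by auto
    ultimately have "norm (of_real r * z) < norm z" using r by (simp add: norm_mult)
    then show False using pos r(3) by fastforce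
  qed
  moreover have "norm z < 1" using z(1) w by (auto simp: K_def)
  ultimately show thesis using that pos by blast
qed

section \<open>The function \<open>f / (z f')\<close> and its differential identities\<close>

definition Q_ST_inverse :: "(complex \<Rightarrow> complex) \<Rightarrow> complex \<Rightarrow> complex" where
  "Q_ST_inverse f z = inverse (Q_ST f z)"

text \<open>The quotient \<open>f z / z\<close> extends holomorphically by \<open>deriv f 0 = 1\<close>, which agrees with
  the value \<open>1\<close> given to \<open>Q_ST f 0\<close>.\<close>

lemma Q_ST_inverse_holomorphic:
  assumes f: "f \<in> class_A" and df: "\<And>z. z \<in> unit_disc \<Longrightarrow> deriv f z \<noteq> 0"
  shows "Q_ST_inverse f holomorphic_on unit_disc"
proof -
  have hol: "f holomorphic_on unit_disc" and f0: "f 0 = 0" "deriv f 0 = 1"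
    using f by (auto simp: class_A_def)
  have "(\<lambda>z. if z = 0 then deriv f 0 else (f z - f 0) / (z - 0)) holomorphic_on unit_disc"
    by (rule pole_lemma[OF hol]) simp
  then have "(\<lambda>z. (if z = 0 then deriv f 0 else (f z - f 0) / (z - 0)) / deriv f z)
      holomorphic_on unit_disc"
    by (intro holomorphic_on_divide holomorphic_deriv[OF hol]) (use df in auto)
  moreover have "(if z = 0 then deriv f 0 else (f z - f 0) / (z - 0)) / deriv f z
      = Q_ST_inverse f z" for z
    by (simp add: Q_ST_inverse_def Q_ST_def f0 divide_simps)
  ultimately show ?thesis by simp
qed

text \<open>Differentiating \<open>f = z q f'\<close> and dividing by \<open>f'\<close> gives the first identity.  Its
  derivative, combined with \<open>Q_SD = z P' + (1 - P\<^sup>2) / 2\<close> for \<open>P = Q_CV\<close>, gives the second.\<close>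

lemma Q_CV_Q_SD_identities:
  fixes f :: "complex \<Rightarrow> complex"
  defines "q \<equiv> Q_ST_inverse f"
  assumes f: "f \<in> class_A" and df: "\<And>z. z \<in> unit_disc \<Longrightarrow> deriv f z \<noteq> 0"
    and z: "z \<in> unit_disc"
  shows "q z * Q_CV f z = 1 - z * deriv q z"
    and "q z * Q_SD f z = - (z * deriv q z + z\<^sup>2 * deriv (deriv q) z)
           - z * deriv q z * Q_CV f z + q z * (1 - (Q_CV f z)\<^sup>2) / 2"
proof -
  have hol: "f holomorphic_on unit_disc" and f0: "f 0 = 0"
    using f by (auto simp: class_A_def)
  note hol' = holomorphic_deriv[OF hol open_ball]
  note hol'' = holomorphic_deriv[OF hol' open_ball]
  have holq: "q holomorphic_on unit_disc"
    unfolding q_def using Q_ST_inverse_holomorphic[OF f df] by blast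
  note holq' = holomorphic_deriv[OF holq open_ball]
  have dq: "(q has_field_derivative deriv q w) (at w)"
    and dq': "(deriv q has_field_derivative deriv (deriv q) w) (at w)"
    and df1: "(f has_field_derivative deriv f w) (at w)"
    and df2: "(deriv f has_field_derivative deriv (deriv f) w) (at w)" if "w \<in> unit_disc" for w
    using that by (auto intro!: holomorphic_derivI[OF _ open_ball] holq holq' hol hol')
  have fq: "f w = w * q w * deriv f w" if "w \<in> unit_disc" for w
    using df[OF that] f0 by (auto simp: q_def Q_ST_inverse_def Q_ST_def)
  have first: "q w * Q_CV f w = 1 - w * deriv q w" if w: "w \<in> unit_disc" for w
  proof -
    have "((\<lambda>w. w * q w * deriv f w) has_field_derivative
        ((1 * q w + deriv q w * w) * deriv f w + deriv (deriv f) w * (w * q w))) (at w)"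
      by (intro DERIV_mult dq[OF w] df2[OF w] DERIV_ident)
    then have "(f has_field_derivative
        ((1 * q w + deriv q w * w) * deriv f w + deriv (deriv f) w * (w * q w))) (at w)"
      by (rule has_field_derivative_transform_within_open[OF _ open_ball w]) (rule fq[symmetric])
    then have "deriv f w = (1 * q w + deriv q w * w) * deriv f w + deriv (deriv f) w * (w * q w)"
      by (rule DERIV_unique[OF df1[OF w]])
    then have "q w * deriv f w + q w * w * deriv (deriv f) w = (1 - w * deriv q w) * deriv f w"
      by algebra
    moreover have "q w * Q_CV f w * deriv f w = q w * deriv f w + q w * w * deriv (deriv f) w"
      using df[OF w] by (simp add: Q_CV_def field_simps)
    ultimately show ?thesis
      using df[OF w] by simp
  qed
  then show "q z * Q_CV f z = 1 - z * deriv q z" using z by blast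

  define N where "N = (\<lambda>w. deriv (deriv f) w / deriv f w)"
  have "N holomorphic_on unit_disc"
    unfolding N_def by (intro holomorphic_on_divide hol' hol'') (use df in auto)
  then have dN: "(N has_field_derivative deriv N z) (at z)"
    using holomorphic_derivI[OF _ open_ball _ ] z by blast
  have CV: "Q_CV f w = 1 + w * N w" for w
    by (simp add: Q_CV_def N_def)
  have "((\<lambda>w. q w * (1 + w * N w)) has_field_derivative
      deriv q z * (1 + z * N z) + (0 + (1 * N z + deriv N z * z)) * q z) (at z)"
    by (intro DERIV_mult DERIV_add DERIV_const DERIV_ident dN dq[OF z])
  then have "((\<lambda>w. 1 - w * deriv q w) has_field_derivative
      deriv q z * (1 + z * N z) + (0 + (1 * N z + deriv N z * z)) * q z) (at z)"
    by (rule has_field_derivative_transform_within_open[OF _ open_ball z])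
      (use first CV in metis)
  moreover have "((\<lambda>w. 1 - w * deriv q w) has_field_derivative
      0 - (1 * deriv q z + deriv (deriv q) z * z)) (at z)"
    by (intro DERIV_mult DERIV_diff DERIV_const DERIV_ident dq'[OF z])
  ultimately have "deriv q z * (1 + z * N z) + (0 + (1 * N z + deriv N z * z)) * q z
      = 0 - (1 * deriv q z + deriv (deriv q) z * z)"
    by (rule DERIV_unique)
  then have "z * (deriv q z * (1 + z * N z)) + z * N z * q z + z\<^sup>2 * deriv N z * q z
      = - (z * deriv q z + z\<^sup>2 * deriv (deriv q) z)"
    by algebra
  moreover have "Q_SD f z = z\<^sup>2 * (deriv N z - 1 / 2 * (N z)\<^sup>2)"
    by (simp add: Q_SD_def schwarzian_def N_def)
  ultimately show "q z * Q_SD f z = - (z * deriv q z + z\<^sup>2 * deriv (deriv q) z)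
           - z * deriv q z * Q_CV f z + q z * (1 - (Q_CV f z)\<^sup>2) / 2"
    unfolding CV by (simp add: field_simps power2_eq_square) algebra
qed

section \<open>The criterion for starlikeness\<close>

theorem theorem2p12:
  fixes \<alpha> \<beta> :: real and f :: "complex \<Rightarrow> complex"
  assumes "\<alpha> > 0" and "\<beta> \<ge> 0"
    and "f \<in> class_A"
    and "\<forall>z\<in>unit_disc. ff'_over_z f z \<noteq> 0"
    and "(\<forall>z\<in>unit_disc. Q_ST f z \<noteq> 0 \<and>
            Re (\<alpha> * (Q_CV f z / Q_ST f z) + \<beta> * (Q_SD f z / Q_ST f z)) < 3 * \<alpha> / 2)
       \<or> (\<forall>z\<in>unit_disc. Q_ST f z \<noteq> 0 \<and> Q_CV f z \<noteq> 0 \<and>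
            Re (\<alpha> * (Q_CV f z / Q_ST f z) + \<beta> * (Q_SD f z / Q_CV f z)) < 3 * \<alpha> / 2)"
  shows "starlike_function f"
proof (rule ccontr)
  assume "\<not> starlike_function f"
  then obtain w where w: "norm w < 1" "Re (Q_ST f w) \<le> 0"
    using assms(3) by (force simp: starlike_function_def)
  define q where "q = Q_ST_inverse f"
  have df: "deriv f z \<noteq> 0" if "z \<in> unit_disc" for z
  proof (cases "z = 0")
    case True
    then show ?thesis using assms(3) by (simp add: class_A_def)
  next
    case False
    have "ff'_over_z f z \<noteq> 0" using assms(4) that by blast
    then show ?thesis using False by (auto simp: ff'_over_z_def)
  qed
  have holq: "q holomorphic_on unit_disc"
    unfolding q_def by (rule Q_ST_inverse_holomorphic[OF assms(3) df])
  have q0: "q 0 = 1" by (simp add: q_def Q_ST_inverse_def Q_ST_def)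
  have "Re (q w) \<le> 0"
    using w(2) by (simp add: q_def Q_ST_inverse_def divide_nonpos_nonneg)
  then obtain z where z: "norm z < 1" "Re (q z) = 0" "\<And>w. norm w < norm z \<Longrightarrow> Re (q w) > 0"
    using exists_first_zero_of_Re[OF holomorphic_on_imp_continuous_on[OF holq] q0 w(1)] by blast
  define s where "s = Re (z * deriv q z)"
  define L where "L = z * deriv q z + z\<^sup>2 * deriv (deriv q) z"
  define P where "P = Q_CV f z"
  have "cball 0 (norm z) \<subseteq> unit_disc" using z(1) by auto
  note bd = first_zero_of_Re[OF holq open_ball this q0 z(2,3)]
  have s: "z * deriv q z = of_real s" "s \<le> - 1 / 2" and L: "Re L \<le> 0"
    using bd by (auto simp: s_def L_def complex_eq_iff)
  have zD: "z \<in> unit_disc" using z(1) by simp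
  have qP: "q z * P = of_real (1 - s)"
    and qSD: "q z * Q_SD f z = - L - s * P + q z * (1 - P\<^sup>2) / 2"
    using Q_CV_Q_SD_identities[OF assms(3) df zD] s(1) by (simp_all add: q_def P_def L_def)
  have ST: "Q_ST f z \<noteq> 0" using assms(5) zD by blast
  then have qz: "q z \<noteq> 0" "x / Q_ST f z = q z * x" for x
    by (simp_all add: q_def Q_ST_inverse_def field_simps)
  \<comment> \<open>A real number divided by a purely imaginary one.\<close>
  have "P = of_real (1 - s) / q z"
    using qP qz(1) by (simp add: field_simps)
  then have ReP: "Re P = 0" using z(2) by (simp add: Re_divide)
  have ReSD: "Re (q z * Q_SD f z) = - Re L"
    unfolding qSD using ReP z(2) by (simp add: power2_eq_square)
  have "P \<noteq> 0" using qP s(2) by (auto simp: complex_eq_iff)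
  then have "Q_SD f z / P = q z * Q_SD f z / of_real (1 - s)"
    unfolding qP[symmetric] using qz(1) by simp
  then have "Re (Q_SD f z / P) = - Re L / (1 - s)"
    by (metis Re_divide_of_real ReSD)
  then have ReSDP: "Re (Q_SD f z / P) \<ge> 0"
    using L s(2) by (simp add: divide_nonpos_pos)
  have CV: "\<alpha> * (3 / 2) \<le> \<alpha> * (1 - s)"
    using assms(1) s(2) by (intro mult_left_mono) auto
  have Re_lin: "Re (of_real a * x + of_real b * y) = a * Re x + b * Re y" for a b x y
    by simp
  from assms(5) show False
  proof
    assume "\<forall>z\<in>unit_disc. Q_ST f z \<noteq> 0 \<and>
            Re (\<alpha> * (Q_CV f z / Q_ST f z) + \<beta> * (Q_SD f z / Q_ST f z)) < 3 * \<alpha> / 2"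
    then have "Re (\<alpha> * (Q_CV f z / Q_ST f z) + \<beta> * (Q_SD f z / Q_ST f z)) < 3 * \<alpha> / 2"
      using zD by blast
    then have "\<alpha> * (1 - s) + \<beta> * (- Re L) < 3 * \<alpha> / 2"
      by (simp only: qz(2) P_def[symmetric] qP Re_lin ReSD Re_complex_of_real)
    moreover have "0 \<le> \<beta> * (- Re L)" using assms(2) L by (intro mult_nonneg_nonneg) auto
    ultimately show False using CV by linarith
  next
    assume "\<forall>z\<in>unit_disc. Q_ST f z \<noteq> 0 \<and> Q_CV f z \<noteq> 0 \<and>
            Re (\<alpha> * (Q_CV f z / Q_ST f z) + \<beta> * (Q_SD f z / Q_CV f z)) < 3 * \<alpha> / 2"
    then have "Re (\<alpha> * (Q_CV f z / Q_ST f z) + \<beta> * (Q_SD f z / Q_CV f z)) < 3 * \<alpha> / 2"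
      using zD by blast
    then have "\<alpha> * (1 - s) + \<beta> * Re (Q_SD f z / P) < 3 * \<alpha> / 2"
      by (simp only: qz(2) P_def[symmetric] qP Re_lin Re_complex_of_real)
    moreover have "0 \<le> \<beta> * Re (Q_SD f z / P)" using assms(2) ReSDP by simp
    ultimately show False using CV by linarith
  qed
qed

end
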